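(* Let $n \geq 1$, let $\alpha_{1},\dots,\alpha_{n}>0$ and $\beta_{1},\dots,\beta_{n}>0$ be real numbers with $\beta_{1}=\min_{1\leq i\leq n}\beta_{i}$, and put $A=\sum_{i=1}^{n}\alpha_{i}$. Define $\gamma_{l}=\sum_{i=1}^{n} \alpha_{i}(1-\beta_{1}/\beta_{i})^{l}/l$ for $l=1,2,\dots$, and define $\delta_{0}=1$ and recursively \[ \delta_{j+1}=\frac{1}{j+1}\sum_{l=1}^{j+1} l\,\gamma_{l}\,\delta_{j+1-l},\qquad j=0,1,2,\dots. \] Then \[ \prod_{i=1}^{n}\Big(\frac{\beta_{1}}{\beta_{i}}\Big)^{\alpha_{i}} \beta_{1}\sum_{j=0}^{\infty}\delta_{j}(A+j)=\sum_{i=1}^{n}\alpha_{i}\beta_{i}. \] *)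

theory Defs
  imports Complex_Main
begin

definition gamma_coeff :: "nat \<Rightarrow> (nat \<Rightarrow> real) \<Rightarrow> (nat \<Rightarrow> real) \<Rightarrow> nat \<Rightarrow> real" where
  "gamma_coeff n \<alpha> \<beta> l = (\<Sum>i = 1..n. \<alpha> i * (1 - \<beta> 1 / \<beta> i) ^ l / real l)"

fun delta_coeff :: "(nat \<Rightarrow> real) \<Rightarrow> nat \<Rightarrow> real" where
  "delta_coeff \<gamma> 0 = 1"
| "delta_coeff \<gamma> (Suc j) =
     1 / real (j + 1) * (\<Sum>l = 1..j + 1. real l * \<gamma> l * delta_coeff \<gamma> (j + 1 - l))"

end

theory Submission
  imports Defs
begin

text \<open>
  Put \<open>x\<^sub>i = 1 - \<beta>\<^sub>1 / \<beta>\<^sub>i \<in> [0, 1)\<close>. The recursion for \<open>\<delta>\<close> says that the generating function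
  \<open>G z = (\<Sum>j. \<delta>\<^sub>j z^j)\<close> satisfies \<open>G' = Q G\<close> with
  \<open>Q z = (\<Sum>l. (l + 1) \<gamma>\<^bsub>l+1\<^esub> z^l) = (\<Sum>i. \<alpha>\<^sub>i x\<^sub>i / (1 - x\<^sub>i z))\<close>, so that
  \<open>G z = (\<Prod>i. (1 - x\<^sub>i z) powr -\<alpha>\<^sub>i)\<close>. All this is valid on a disc of radius greater than \<open>1\<close>, and
  the series in question is \<open>A G 1 + G' 1 = (A + Q 1) G 1\<close>.
\<close>

text \<open>Clearing the factor \<open>1 / (j + 1)\<close> and shifting \<open>l\<close> to
  \<open>i + 1\<close> makes the recursion a convolution. As \<open>diffs\<close> lists the
  coefficients of a derivative, this is \<open>G' = Q G\<close> coefficient by coefficient.\<close>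

lemma diffs_delta_coeff:
  "diffs (delta_coeff \<gamma>) n = (\<Sum>i\<le>n. diffs \<gamma> i * delta_coeff \<gamma> (n - i))"
proof -
  have "(\<Sum>l = 1..n + 1. real l * \<gamma> l * delta_coeff \<gamma> (n + 1 - l))
      = (\<Sum>i\<le>n. real (Suc i) * \<gamma> (Suc i) * delta_coeff \<gamma> (n - i))"
    using sum.shift_bounds_cl_Suc_ivl
      [of "\<lambda>l. real l * \<gamma> l * delta_coeff \<gamma> (n + 1 - l)" 0 n]
    by (simp add: atLeast0AtMost)
  then show ?thesis
    by (simp add: diffs_def)
qed

text \<open>A Cauchy-type estimate taken from the recursion alone. It gives convergence of
  \<open>G\<close> before any closed form is known.\<close>

lemma delta_coeff_rescaled_bounded:
  assumes "\<rho> > 0" and summ: "summable (\<lambda>l. \<bar>diffs \<gamma> l\<bar> * \<rho> ^ l)"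
  obtains M where "\<And>j. \<bar>delta_coeff \<gamma> j\<bar> * \<rho> ^ j \<le> M"
proof -
  define q where "q l = \<bar>diffs \<gamma> l\<bar> * \<rho> ^ l" for l
  define d where "d j = \<bar>delta_coeff \<gamma> j\<bar> * \<rho> ^ j" for j
  define B where "B = \<rho> * (\<Sum>l. q l)"
  have q_nonneg: "q l \<ge> 0" for l
    using \<open>\<rho> > 0\<close> by (simp add: q_def)
  obtain N :: nat where N: "B \<le> real N"
    using real_arch_simple by blast
  define M where "M = Max (d ` {..N})"
  have M: "d j \<le> M" if "j \<le> N" for j
    unfolding M_def using that by (intro Max_ge) auto
  have "0 \<le> d 0"
    using \<open>\<rho> > 0\<close> by (simp add: d_def)
  also have "\<dots> \<le> M"
    by (rule M) simp
  finally have "M \<ge> 0" .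
  \<comment> \<open>Past index \<open>B\<close>, the factor \<open>1 / (j + 1)\<close> absorbs the sum of the weights \<open>q\<close>.\<close>
  have "d j \<le> M" for j
  proof (induction j rule: less_induct)
    case (less j)
    show ?case
    proof (cases "j \<le> N")
      case True
      then show ?thesis by (rule M)
    next
      case False
      then obtain k where k: "j = Suc k" "N \<le> k"
        by (cases j) auto
      \<comment> \<open>Multiplying by \<open>j = Suc k\<close> turns \<open>d j\<close> into a
        derivative coefficient. One of the \<open>k + 1\<close> powers of \<rho> stays outside the
        convolution, which explains the factor \<rho> in \<open>B\<close>.\<close>
      have "real j * d j = \<bar>diffs (delta_coeff \<gamma>) k\<bar> * \<rho> ^ Suc k"
        by (simp add: k d_def diffs_def abs_mult del: delta_coeff.simps)
      also have "\<dots> \<le> (\<Sum>i\<le>k. \<bar>diffs \<gamma> i * delta_coeff \<gamma> (k - i)\<bar>) * \<rho> ^ Suc k"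
        unfolding diffs_delta_coeff using \<open>\<rho> > 0\<close> by (intro mult_right_mono sum_abs) auto
      also have "\<dots> = \<rho> * (\<Sum>i\<le>k. q i * d (k - i))"
        unfolding sum_distrib_left sum_distrib_right
      proof (rule sum.cong)
        fix i assume "i \<in> {..k}"
        then have "\<rho> ^ k = \<rho> ^ i * \<rho> ^ (k - i)"
          by (simp flip: power_add)
        then show "\<bar>diffs \<gamma> i * delta_coeff \<gamma> (k - i)\<bar> * \<rho> ^ Suc k = \<rho> * (q i * d (k - i))"
          by (simp add: q_def d_def abs_mult)
      qed simp
      also have "\<dots> \<le> \<rho> * (\<Sum>i\<le>k. q i * M)"
        using \<open>\<rho> > 0\<close> q_nonneg less.IH k by (intro mult_left_mono sum_mono) auto
      also have "\<dots> = \<rho> * (\<Sum>i\<le>k. q i) * M"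
        by (simp add: sum_distrib_right)
      also have "\<dots> \<le> B * M"
        unfolding B_def using \<open>\<rho> > 0\<close> \<open>M \<ge> 0\<close> q_nonneg summ
        by (intro mult_right_mono mult_left_mono sum_le_suminf) (auto simp: q_def)
      also have "\<dots> \<le> real j * M"
        using N k \<open>M \<ge> 0\<close> by (intro mult_right_mono) auto
      finally show ?thesis
        by (simp add: k)
    qed
  qed
  then show thesis
    using that unfolding d_def by blast
qed

text \<open>Boundedness at radius \<rho> gives domination by a geometric series of ratio
  \<open>\<bar>z\<bar> / \<rho>\<close>. Convergence is absolute, as the Cauchy product below
  demands.\<close>

lemma summable_delta_coeff:
  fixes \<gamma> :: "nat \<Rightarrow> real"
  assumes "summable (\<lambda>l. \<bar>diffs \<gamma> l\<bar> * \<rho> ^ l)" and "\<bar>z\<bar> < \<rho>"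
  shows "summable (\<lambda>j. \<bar>delta_coeff \<gamma> j * z ^ j\<bar>)"
proof -
  have "\<rho> > 0"
    using assms(2) by linarith
  obtain M where M: "\<And>j. \<bar>delta_coeff \<gamma> j\<bar> * \<rho> ^ j \<le> M"
    using delta_coeff_rescaled_bounded[OF \<open>\<rho> > 0\<close> assms(1)] by blast
  have "summable (\<lambda>j. M * (\<bar>z\<bar> / \<rho>) ^ j)"
    using assms(2) \<open>\<rho> > 0\<close> by (intro summable_mult summable_geometric) auto
  moreover have "\<bar>delta_coeff \<gamma> j * z ^ j\<bar> \<le> M * (\<bar>z\<bar> / \<rho>) ^ j" for j
  proof -
    have "\<bar>delta_coeff \<gamma> j * z ^ j\<bar> = (\<bar>delta_coeff \<gamma> j\<bar> * \<rho> ^ j) * (\<bar>z\<bar> / \<rho>) ^ j"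
      using \<open>\<rho> > 0\<close> by (simp add: abs_mult power_abs power_divide)
    also have "\<dots> \<le> M * (\<bar>z\<bar> / \<rho>) ^ j"
      using M \<open>\<rho> > 0\<close> by (intro mult_right_mono) auto
    finally show ?thesis .
  qed
  ultimately show ?thesis
    by (elim summable_comparison_test'[where N = 0]) (metis real_norm_def abs_idempotent)
qed

text \<open>The differential equation as an identity of functions: both factors converge absolutely,
  so Cauchy's product applies to the convolution.\<close>

lemma suminf_diffs_delta_coeff:
  fixes \<gamma> :: "nat \<Rightarrow> real"
  assumes "summable (\<lambda>l. \<bar>diffs \<gamma> l\<bar> * \<rho> ^ l)" and "\<bar>z\<bar> < \<rho>"
  shows "(\<Sum>n. diffs (delta_coeff \<gamma>) n * z ^ n)
       = (\<Sum>n. diffs \<gamma> n * z ^ n) * (\<Sum>n. delta_coeff \<gamma> n * z ^ n)"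
proof -
  have "summable (\<lambda>n. norm (diffs \<gamma> n * z ^ n))"
  proof (rule summable_comparison_test'[OF assms(1)])
    show "norm (norm (diffs \<gamma> n * z ^ n)) \<le> \<bar>diffs \<gamma> n\<bar> * \<rho> ^ n" for n
      using assms(2) by (simp add: abs_mult power_abs mult_left_mono power_mono)
  qed
  moreover have "summable (\<lambda>n. norm (delta_coeff \<gamma> n * z ^ n))"
    using summable_delta_coeff[OF assms] by simp
  ultimately have "(\<Sum>n. diffs \<gamma> n * z ^ n) * (\<Sum>n. delta_coeff \<gamma> n * z ^ n)
    = (\<Sum>n. \<Sum>i\<le>n. diffs \<gamma> i * z ^ i * (delta_coeff \<gamma> (n - i) * z ^ (n - i)))"
    by (rule Cauchy_product)
  also have "\<dots> = (\<Sum>n. diffs (delta_coeff \<gamma>) n * z ^ n)"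
  proof (rule suminf_cong)
    fix n
    show "(\<Sum>i\<le>n. diffs \<gamma> i * z ^ i * (delta_coeff \<gamma> (n - i) * z ^ (n - i)))
        = diffs (delta_coeff \<gamma>) n * z ^ n"
      unfolding diffs_delta_coeff sum_distrib_right
    proof (rule sum.cong)
      fix i assume "i \<in> {..n}"
      then have "z ^ n = z ^ i * z ^ (n - i)"
        by (simp flip: power_add)
      then show "diffs \<gamma> i * z ^ i * (delta_coeff \<gamma> (n - i) * z ^ (n - i))
          = diffs \<gamma> i * delta_coeff \<gamma> (n - i) * z ^ n"
        by simp
    qed simp
  qed
  finally show ?thesis ..
qed

text \<open>These are the values \<open>G 1\<close> and \<open>G' 1\<close>. The assumption on
  \<gamma> starts at index 1, the first one that the recursion reads.\<close>

lemma delta_coeff_power_sums: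
  fixes x \<alpha> :: "'a \<Rightarrow> real"
  assumes "finite I" and x: "\<And>i. i \<in> I \<Longrightarrow> 0 \<le> x i \<and> x i < 1"
    and \<gamma>: "\<And>l. \<gamma> (Suc l) = (\<Sum>i\<in>I. \<alpha> i * x i ^ Suc l / real (Suc l))"
  shows "delta_coeff \<gamma> sums (\<Prod>i\<in>I. (1 - x i) powr - \<alpha> i)"
    and "(\<lambda>j. real j * delta_coeff \<gamma> j) sums
      ((\<Sum>i\<in>I. \<alpha> i * x i / (1 - x i)) * (\<Prod>i\<in>I. (1 - x i) powr - \<alpha> i))"
proof -
  \<comment> \<open>Inserting 0 keeps the maximum defined for empty \<open>I\<close> and makes
    \<open>c\<close> nonnegative.\<close>
  define c where "c = Max (insert 0 (x ` I))"
  have c: "0 \<le> c" "c < 1" "\<And>i. i \<in> I \<Longrightarrow> x i \<le> c"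
    using \<open>finite I\<close> x by (auto simp: c_def)
  \<comment> \<open>Any \<rho> strictly between 1 and \<open>1 / c\<close> (no upper limit if
    \<open>c = 0\<close>) would do; here \<open>c * \<rho> = 2 * c / (1 + c) < 1\<close>. The point
    1 then lies inside the disc.\<close>
  define \<rho> where "\<rho> = 2 / (1 + c)"
  have \<rho>: "1 < \<rho>" "c * \<rho> < 1"
    using c by (auto simp: \<rho>_def field_simps)
  have x\<rho>: "x i * \<rho> < 1" if "i \<in> I" for i
    using mult_right_mono[OF c(3)[OF that], of \<rho>] \<rho> by linarith
  have diffs_\<gamma>: "diffs \<gamma> l = (\<Sum>i\<in>I. \<alpha> i * x i * x i ^ l)" for l
    by (simp add: diffs_def \<gamma> sum_distrib_left mult.assoc del: of_nat_Suc)
  have summ: "summable (\<lambda>l. \<bar>diffs \<gamma> l\<bar> * \<rho> ^ l)"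
  proof (rule summable_comparison_test'[where N = 0])
    show "summable (\<lambda>l. \<Sum>i\<in>I. \<bar>\<alpha> i * x i\<bar> * (x i * \<rho>) ^ l)"
      using x x\<rho> \<rho> by (intro summable_sum summable_mult summable_geometric) (auto simp: abs_mult)
    fix l
    have "\<bar>diffs \<gamma> l\<bar> * \<rho> ^ l \<le> (\<Sum>i\<in>I. \<bar>\<alpha> i * x i * x i ^ l\<bar>) * \<rho> ^ l"
      unfolding diffs_\<gamma> using \<rho> by (intro mult_right_mono sum_abs) auto
    also have "\<dots> = (\<Sum>i\<in>I. \<bar>\<alpha> i * x i\<bar> * (x i * \<rho>) ^ l)"
      unfolding sum_distrib_right
      using x by (intro sum.cong) (auto simp: abs_mult power_mult_distrib)
    finally show "norm (\<bar>diffs \<gamma> l\<bar> * \<rho> ^ l) \<le> (\<Sum>i\<in>I. \<bar>\<alpha> i * x i\<bar> * (x i * \<rho>) ^ l)"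
      using \<rho> by simp
  qed
  define Q where "Q z = (\<Sum>i\<in>I. \<alpha> i * x i / (1 - x i * z))" for z
  define G where "G z = (\<Sum>j. delta_coeff \<gamma> j * z ^ j)" for z
  \<comment> \<open>\<open>P\<close> is the reciprocal of the expected closed form of
    \<open>G\<close>, so that it serves as an integrating factor.\<close>
  define P where "P z = (\<Prod>i\<in>I. (1 - x i * z) powr \<alpha> i)" for z
  have xz: "x i * z < 1" if "i \<in> I" "0 \<le> z" "z \<le> 1" for i z
    using mult_mono[of "x i" "x i" z 1] x[OF that(1)] that by auto
  have Q: "(\<Sum>n. diffs \<gamma> n * z ^ n) = Q z" if "0 \<le> z" "z \<le> 1" for z
  proof -
    have "(\<lambda>n. \<alpha> i * x i * (x i * z) ^ n) sums (\<alpha> i * x i * (1 / (1 - x i * z)))"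
      if "i \<in> I" for i
      using xz[OF that \<open>0 \<le> z\<close> \<open>z \<le> 1\<close>] x[OF that] \<open>0 \<le> z\<close>
      by (intro sums_mult geometric_sums) auto
    then have "(\<lambda>n. \<Sum>i\<in>I. \<alpha> i * x i * (x i * z) ^ n) sums
        (\<Sum>i\<in>I. \<alpha> i * x i * (1 / (1 - x i * z)))"
      by (rule sums_sum)
    then show ?thesis
      by (simp add: diffs_\<gamma> Q_def sum_distrib_right power_mult_distrib mult.assoc sums_unique[symmetric])
  qed
  have summ_\<delta>: "summable (\<lambda>j. delta_coeff \<gamma> j * z ^ j)" if "\<bar>z\<bar> < \<rho>" for z
    using summable_delta_coeff[OF summ that] by (rule summable_rabs_cancel)
  have derG: "(G has_real_derivative Q z * G z) (at z)" if "0 \<le> z" "z \<le> 1" for z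
  proof -
    \<comment> \<open>Termwise differentiation asks for summability at a point beyond
      \<open>z\<close>, and summability is known only below \<rho>; the midpoint of 1 and \<rho>
      meets both demands.\<close>
    define K where "K = (1 + \<rho>) / 2"
    have K: "1 < K" "K < \<rho>"
      using \<rho> by (auto simp: K_def)
    have "(G has_real_derivative (\<Sum>n. diffs (delta_coeff \<gamma>) n * z ^ n)) (at z)"
      unfolding G_def using K that
      by (intro termdiffs_strong[where K = K] summ_\<delta>) auto
    then show ?thesis
      using suminf_diffs_delta_coeff[OF summ, of z] Q[OF that] that \<rho> by (simp add: G_def)
  qed
  have derP: "(P has_real_derivative - Q z * P z) (at z)" if "0 \<le> z" "z \<le> 1" for z
  proof -
    have "((\<lambda>z. (1 - x i * z) powr \<alpha> i) has_real_derivative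
        - (\<alpha> i * x i / (1 - x i * z)) * (1 - x i * z) powr \<alpha> i) (at z)" if "i \<in> I" for i
      using xz[OF that \<open>0 \<le> z\<close> \<open>z \<le> 1\<close>]
      by (auto intro!: derivative_eq_intros simp: powr_diff field_simps)
    then have "(P has_real_derivative
        (\<Sum>i\<in>I. - (\<alpha> i * x i / (1 - x i * z)) * (1 - x i * z) powr \<alpha> i *
          (\<Prod>j\<in>I - {i}. (1 - x j * z) powr \<alpha> j))) (at z)"
      unfolding P_def by (rule has_field_derivative_prod)
    \<comment> \<open>Restoring the missing factor makes every summand of the product rule a
      multiple of \<open>P z\<close>; the multipliers add up to \<open>- Q z\<close>.\<close>
    moreover have "P z = (1 - x i * z) powr \<alpha> i * (\<Prod>j\<in>I - {i}. (1 - x j * z) powr \<alpha> j)"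
      if "i \<in> I" for i
      unfolding P_def using \<open>finite I\<close> that by (rule prod.remove)
    ultimately show ?thesis
      by (simp add: Q_def sum_distrib_right sum_negf mult.assoc cong: sum.cong)
  qed
  \<comment> \<open>The derivative of \<open>G * P\<close> is \<open>Q G P - Q G P = 0\<close> on
    the interval, and the value at 0 is \<open>delta_coeff \<gamma> 0 = 1\<close>.\<close>
  have "G 1 * P 1 = G 0 * P 0"
  proof (rule DERIV_isconst2[of 0 1 "\<lambda>z. G z * P z"])
    have der: "((\<lambda>z. G z * P z) has_real_derivative 0) (at z)" if "0 \<le> z" "z \<le> 1" for z
      using DERIV_mult[OF derG[OF that] derP[OF that]] by (simp add: algebra_simps)
    show "continuous_on {0..1} (\<lambda>z. G z * P z)"
      using der by (intro DERIV_atLeastAtMost_imp_continuous_on) auto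
    show "((\<lambda>z. G z * P z) has_real_derivative 0) (at z)" if "0 < z" "z < 1" for z
      using der that by simp
  qed auto
  also have "\<dots> = 1"
    by (simp add: G_def P_def)
  finally have "G 1 = inverse (P 1)"
    by (simp add: inverse_unique mult.commute)
  also have "\<dots> = (\<Prod>i\<in>I. (1 - x i) powr - \<alpha> i)"
    by (simp add: P_def powr_minus prod_inversef[symmetric] comp_def)
  finally have G1: "G 1 = (\<Prod>i\<in>I. (1 - x i) powr - \<alpha> i)" .
  show "delta_coeff \<gamma> sums (\<Prod>i\<in>I. (1 - x i) powr - \<alpha> i)"
    using summable_sums[OF summ_\<delta>[of 1]] \<rho> by (simp flip: G1 add: G_def)
  have "summable (\<lambda>n. diffs (delta_coeff \<gamma>) n * 1 ^ n)"
    using \<rho> by (intro termdiff_converges[where K = \<rho>] summ_\<delta>) auto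
  \<comment> \<open>Passing from \<open>diffs\<close> to the weights \<open>real n\<close> shifts
    the index by one; the extra term at 0 vanishes.\<close>
  then have "(\<lambda>n. real n * delta_coeff \<gamma> n * 1 ^ (n - Suc 0)) sums
      (\<Sum>n. diffs (delta_coeff \<gamma>) n * 1 ^ n)"
    by (rule diffs_equiv)
  moreover have "(\<Sum>n. diffs (delta_coeff \<gamma>) n * 1 ^ n) = Q 1 * G 1"
    using suminf_diffs_delta_coeff[OF summ, of 1] Q[of 1] \<rho> by (simp add: G_def)
  ultimately show "(\<lambda>j. real j * delta_coeff \<gamma> j) sums
      ((\<Sum>i\<in>I. \<alpha> i * x i / (1 - x i)) * (\<Prod>i\<in>I. (1 - x i) powr - \<alpha> i))"
    by (simp add: Q_def flip: G1)
qed

text \<open>Since \<open>suminf\<close> is total, convergence of the series is asserted as a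
  conjunct of its own.\<close>

theorem theorem3p2:
  fixes n :: nat and \<alpha> \<beta> :: "nat \<Rightarrow> real" and A :: real and \<gamma> \<delta> :: "nat \<Rightarrow> real"
  assumes "n \<ge> 1"
    and "\<And>i. i \<in> {1..n} \<Longrightarrow> \<alpha> i > 0"
    and "\<And>i. i \<in> {1..n} \<Longrightarrow> \<beta> i > 0"
    and "\<beta> 1 = Min (\<beta> ` {1..n})"
  defines "A \<equiv> \<Sum>i = 1..n. \<alpha> i"
    and "\<gamma> \<equiv> gamma_coeff n \<alpha> \<beta>"
    and "\<delta> \<equiv> delta_coeff \<gamma>"
  shows "summable (\<lambda>j. \<delta> j * (A + real j)) \<and>
    (\<Prod>i = 1..n. (\<beta> 1 / \<beta> i) powr \<alpha> i) * \<beta> 1 * (\<Sum>j. \<delta> j * (A + real j))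
      = (\<Sum>i = 1..n. \<alpha> i * \<beta> i)"
proof -
  define x where "x i = 1 - \<beta> 1 / \<beta> i" for i
  define S where "S = (\<Sum>i = 1..n. \<alpha> i * x i / (1 - x i))"
  define p where "p = (\<Prod>i = 1..n. (\<beta> 1 / \<beta> i) powr \<alpha> i)"
  have \<beta>: "0 < \<beta> 1" "0 < \<beta> i" "\<beta> 1 \<le> \<beta> i" if "i \<in> {1..n}" for i
    using assms(1,3,4) that by auto
  have x: "0 \<le> x i \<and> x i < 1" if "i \<in> {1..n}" for i
    using \<beta>[OF that] by (simp add: x_def field_simps)
  have \<gamma>: "\<gamma> (Suc l) = (\<Sum>i = 1..n. \<alpha> i * x i ^ Suc l / real (Suc l))" for l
    by (simp add: \<gamma>_def gamma_coeff_def x_def)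
  \<comment> \<open>As \<open>1 - x i = \<beta> 1 / \<beta> i\<close>, the value of
    \<open>G 1\<close> is exactly what the prefactor \<open>p\<close> cancels.\<close>
  have p_inverse: "(\<Prod>i = 1..n. (1 - x i) powr - \<alpha> i) = inverse p"
    by (simp add: p_def x_def powr_minus prod_inversef[symmetric] comp_def)
  note sums = delta_coeff_power_sums[OF finite_atLeastAtMost x \<gamma>, folded \<delta>_def S_def, unfolded p_inverse]
  have "(\<lambda>j. A * \<delta> j + real j * \<delta> j) sums (A * inverse p + S * inverse p)"
    by (intro sums_add sums_mult sums)
  then have total: "(\<lambda>j. \<delta> j * (A + real j)) sums ((A + S) * inverse p)"
    by (simp add: algebra_simps)
  have "p > 0"
    unfolding p_def using \<beta> assms(1) by (intro prod_pos) fastforce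
  \<comment> \<open>Termwise,
    \<open>1 + x i / (1 - x i) = 1 / (1 - x i) = \<beta> i / \<beta> 1\<close>.\<close>
  have "\<beta> 1 * (A + S) = (\<Sum>i = 1..n. \<alpha> i * \<beta> i)"
    unfolding A_def S_def sum.distrib[symmetric] sum_distrib_left
  proof (rule sum.cong)
    fix i assume "i \<in> {1..n}"
    from \<beta>[OF this] show "\<beta> 1 * (\<alpha> i + \<alpha> i * x i / (1 - x i)) = \<alpha> i * \<beta> i"
      by (simp add: x_def field_simps)
  qed simp
  then have "p * \<beta> 1 * ((A + S) * inverse p) = (\<Sum>i = 1..n. \<alpha> i * \<beta> i)"
    using \<open>p > 0\<close> by (simp add: field_simps)
  with total show ?thesis
    unfolding p_def by (auto simp: sums_iff)
qed

end
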